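(* Let $k\ge 3$ be an integer and let $K>0$ be real. Then there is a finite poset $P$ with $e(P)=k$ and $\pi^-(P)>K$. Explicitly, for any integer $L>2K$ and $m=2^{L^2}+1$, one may take $P$ to be the poset obtained from $S_2(m,0)$ by adjoining a chain of $k-2$ new elements below its unique minimum.
   Context: For $m\ge2$, $S_2(m,0)=\{X\subseteq[m]:|X|\le2\}$, ordered by inclusion; its unique minimum is $\varnothing$. A family $\mathcal G$ of sets is a weak copy of a finite poset $(P,\leqslant)$ if there is a bijection $\psi:P\to\mathcal G$ such that $\psi(p)\subseteq\psi(p')$ whenever $p\leqslant p'$. A family $\mathcal F$ is (weak) $P$-free if no subfamily of it is a weak copy of $P$. $\mathrm{La}(n,P)$ is the maximum size of a weak $P$-free family $\mathcal F\subseteq 2^{[n]}$, where $[n]=\{1,\dots,n\}$, and $\pi^-(P)=\liminf_{n\to\infty}\mathrm{La}(n,P)/\binom{n}{\lfloor n/2\rfloor}$. $e(P)$ is the maximum integer $k$ such that, for every $n$, the union of any $k$ consecutive layers of $2^{[n]}$ is weak $P$-free; a layer of $2^{[n]}$ is $\binom{[n]}{s}=\{Y\subseteq[n]:|Y|=s\}$. *)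

theory Defs
  imports Complex_Main "HOL-Library.Liminf_Limsup" "HOL-Library.Extended_Real"
begin

text \<open>A poset is given by its reflexive order relation \<open>P\<close>; its ground set is \<^term>\<open>Field P\<close>.
  The empty poset is excluded: the empty family is a weak copy of it, so no family is free of it
  and the maxima \<open>La\<close> and \<open>e_num\<close> below would not exist.\<close>

definition finite_poset :: "'a rel \<Rightarrow> bool" where
  "finite_poset P \<longleftrightarrow> Partial_order P \<and> finite (Field P) \<and> Field P \<noteq> {}"

definition weak_copy :: "'a rel \<Rightarrow> 'b set set \<Rightarrow> bool" where
  "weak_copy P G \<longleftrightarrow>
     (\<exists>\<psi>. bij_betw \<psi> (Field P) G \<and> (\<forall>p p'. (p, p') \<in> P \<longrightarrow> \<psi> p \<subseteq> \<psi> p'))"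

definition weak_free :: "'a rel \<Rightarrow> 'b set set \<Rightarrow> bool" where
  "weak_free P F \<longleftrightarrow> \<not> (\<exists>G\<subseteq>F. weak_copy P G)"

definition La :: "nat \<Rightarrow> 'a rel \<Rightarrow> nat" where
  "La n P = Max {card F | F. F \<subseteq> Pow {1..n} \<and> weak_free P F}"

definition pi_minus :: "'a rel \<Rightarrow> ereal" where
  "pi_minus P = liminf (\<lambda>n. ereal (real (La n P) / real (n choose (n div 2))))"

definition layer :: "nat \<Rightarrow> nat \<Rightarrow> nat set set" where
  "layer n s = {Y. Y \<subseteq> {1..n} \<and> card Y = s}"

text \<open>The guard \<^prop>\<open>s + k \<le> n + 1\<close> says that \<open>s, \<dots>, s + k - 1\<close> are indices of actual layers,
  i.e. lie in \<open>{0..n}\<close>.\<close>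

definition e_num :: "'a rel \<Rightarrow> nat" where
  "e_num P = (GREATEST k. \<forall>n s. s + k \<le> n + 1 \<longrightarrow> weak_free P (\<Union>i\<in>{s..<s + k}. layer n i))"

definition S2 :: "nat \<Rightarrow> nat set rel" where
  "S2 m = {(X, Y). X \<subseteq> Y \<and> Y \<subseteq> {1..m} \<and> card X \<le> 2 \<and> card Y \<le> 2}"

text \<open>A chain of \<open>j\<close> new elements placed below every element of \<open>P\<close> (equivalently, by
  transitivity, below the minimum of \<open>P\<close> when it has one).\<close>

definition add_chain_below :: "nat \<Rightarrow> 'a rel \<Rightarrow> (nat + 'a) rel" where
  "add_chain_below j P =
     {(Inl a, Inl b) | a b. a \<le> b \<and> b < j}
     \<union> {(Inl a, Inr x) | a x. a < j \<and> x \<in> Field P}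
     \<union> {(Inr x, Inr y) | x y. (x, y) \<in> P}"

end

theory Submission
  imports Defs "HOL-Library.FuncSet"
begin

text \<open>Assign to every point of \<open>[n]\<close> a uniformly random vector of \<open>\<bbbF>\<^sub>2\<^sup>d\<close>, with
  \<open>d = \<lfloor>n/2\<rfloor> + 1\<close>, and take the sets in the layers \<open>d - L, \<dots>, d - 1\<close> whose vectors are linearly
  independent. By the union bound over the possible vanishing subsums, an \<open>r\<close>-set is dependent with
  probability at most \<open>2\<^bsup>r - d\<^esup> \<le> 1/2\<close>, so some choice of vectors gives a family of asymptotic
  relative size at least \<open>L/2\<close>. In a weak copy of \<open>S\<^sub>2(m,0)\<close> inside this family, let \<open>A\<close> be the image of the
  minimum and \<open>B\<^sub>1, \<dots>, B\<^sub>m\<close> the images of the singletons. Each \<open>B\<^sub>i \<union> B\<^sub>j\<close> lies in a member of the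
  family, hence is independent, so \<open>B\<^sub>i\<close> is determined by the set of cosets of the span of \<open>A\<close> that
  \<open>B\<^sub>i - A\<close> meets. There are at most \<open>2\<^sup>L\<close> cosets and \<open>B\<^sub>i - A\<close> has at most \<open>L\<close> elements, so
  \<open>m \<le> (2\<^sup>L)\<^sup>L\<close>.\<close>

section \<open>Linear algebra over F_2: subset sums, independence and cosets\<close>

lemma odd_card_sym_diff:
  assumes "finite Y" "finite Z"
  shows "odd (card (sym_diff Y Z)) \<longleftrightarrow> odd (card Y) \<noteq> odd (card Z)"
proof -
  have "card Y = card (Y \<inter> Z) + card (Y - Z)"
    by (rule card_Int_Diff[OF assms(1)])
  moreover have "card Z = card (Y \<inter> Z) + card (Z - Y)"
    using card_Int_Diff[OF assms(2), of Y] by (simp add: Int_commute)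
  moreover have "card (sym_diff Y Z) = card (Y - Z) + card (Z - Y)"
    using assms by (intro card_Un_disjoint) auto
  ultimately show ?thesis by presburger
qed

text \<open>Vectors of \<open>\<bbbF>\<^sub>2\<^sup>d\<close> are encoded as subsets of \<open>{..<d}\<close>, with addition \<^term>\<open>sym_diff\<close>.\<close>

definition xor_sum :: "('b \<Rightarrow> nat set) \<Rightarrow> 'b set \<Rightarrow> nat set" where
  "xor_sum v Y = {i. odd (card {y \<in> Y. i \<in> v y})}"

text \<open>Over F_2 linear combinations are subset sums, so this is linear independence of the
  indexed family; a vector repeated at two indices counts as a dependence.\<close>

definition xor_indep :: "('b \<Rightarrow> nat set) \<Rightarrow> 'b set \<Rightarrow> bool" where
  "xor_indep v X \<longleftrightarrow> (\<forall>Y\<subseteq>X. Y \<noteq> {} \<longrightarrow> xor_sum v Y \<noteq> {})"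

text \<open>The coset of \<open>u\<close> modulo the span of the vectors indexed by
  \<open>A\<close>.\<close>

definition xor_coset :: "('b \<Rightarrow> nat set) \<Rightarrow> 'b set \<Rightarrow> nat set \<Rightarrow> nat set set" where
  "xor_coset v A u = (\<lambda>Y. sym_diff u (xor_sum v Y)) ` Pow A"

lemma xor_sum_empty [simp]: "xor_sum v {} = {}"
  by (simp add: xor_sum_def)

lemma xor_sum_singleton [simp]: "xor_sum v {y} = v y"
proof -
  have "{z \<in> {y}. i \<in> v z} = (if i \<in> v y then {y} else {})" for i by auto
  then show ?thesis by (auto simp: xor_sum_def)
qed

lemma xor_sum_sym_diff:
  assumes "finite Y" "finite Z"
  shows "xor_sum v (sym_diff Y Z) = sym_diff (xor_sum v Y) (xor_sum v Z)"
proof -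
  have "{y \<in> sym_diff Y Z. i \<in> v y} = sym_diff {y \<in> Y. i \<in> v y} {y \<in> Z. i \<in> v y}" for i
    by auto
  then show ?thesis
    using odd_card_sym_diff[of "{y \<in> Y. _ \<in> v y}" "{y \<in> Z. _ \<in> v y}"] assms
    by (auto simp: xor_sum_def)
qed

lemma xor_sum_insert:
  assumes "finite Y" "y \<notin> Y"
  shows "xor_sum v (insert y Y) = sym_diff (v y) (xor_sum v Y)"
proof -
  have "insert y Y = sym_diff {y} Y" using assms by auto
  then show ?thesis using xor_sum_sym_diff[of "{y}" Y v] assms by simp
qed

lemma xor_sum_subset:
  assumes "\<And>y. y \<in> Y \<Longrightarrow> v y \<subseteq> S"
  shows "xor_sum v Y \<subseteq> S"
proof
  fix i assume "i \<in> xor_sum v Y"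
  then have "{y \<in> Y. i \<in> v y} \<noteq> {}" unfolding xor_sum_def by (metis (lifting) card.empty even_zero mem_Collect_eq)
  then show "i \<in> S" using assms by blast
qed

lemma xor_sum_cong: "(\<And>y. y \<in> Y \<Longrightarrow> v y = w y) \<Longrightarrow> xor_sum v Y = xor_sum w Y"
  unfolding xor_sum_def by (metis (mono_tags, lifting) Collect_cong)

lemma xor_indep_mono: "xor_indep v X \<Longrightarrow> Y \<subseteq> X \<Longrightarrow> xor_indep v Y"
  by (auto simp: xor_indep_def)

text \<open>Two subsets of \<open>A\<close> with equal sums have a symmetric difference summing to
  zero, so independence makes them equal.\<close>

lemma card_xor_coset:
  assumes "finite A" "xor_indep v A"
  shows "card (xor_coset v A u) = 2 ^ card A"
proof -
  have "inj_on (\<lambda>Y. sym_diff u (xor_sum v Y)) (Pow A)"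
  proof
    fix Y Z assume YZ: "Y \<in> Pow A" "Z \<in> Pow A"
      and "sym_diff u (xor_sum v Y) = sym_diff u (xor_sum v Z)"
    then have "sym_diff (xor_sum v Y) (xor_sum v Z) = {}" by blast
    then have "xor_sum v (sym_diff Y Z) = {}"
      using xor_sum_sym_diff YZ assms(1) by (metis Pow_iff finite_subset)
    moreover have "sym_diff Y Z \<subseteq> A" using YZ by auto
    ultimately have "sym_diff Y Z = {}" using assms(2) unfolding xor_indep_def by blast
    then show "Y = Z" by blast
  qed
  then show ?thesis using assms(1) by (simp add: xor_coset_def card_image card_Pow)
qed

lemma xor_coset_self: "u \<in> xor_coset v A u"
  unfolding xor_coset_def by (rule image_eqI[of _ _ "{}"]) auto

lemma xor_coset_sym: "w \<in> xor_coset v A u \<Longrightarrow> u \<in> xor_coset v A w"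
  unfolding xor_coset_def by blast

lemma xor_coset_subset:
  assumes "finite A" "w \<in> xor_coset v A u"
  shows "xor_coset v A w \<subseteq> xor_coset v A u"
proof
  fix x assume "x \<in> xor_coset v A w"
  then obtain Z where Z: "Z \<subseteq> A" "x = sym_diff w (xor_sum v Z)" by (auto simp: xor_coset_def)
  obtain Y where Y: "Y \<subseteq> A" "w = sym_diff u (xor_sum v Y)" using assms by (auto simp: xor_coset_def)
  have "x = sym_diff u (xor_sum v (sym_diff Y Z))"
    using xor_sum_sym_diff[of Y Z v] Y Z assms(1) finite_subset by blast
  then show "x \<in> xor_coset v A u" unfolding xor_coset_def using Y Z by blast
qed

lemma xor_coset_eq:
  assumes "finite A" "w \<in> xor_coset v A u"
  shows "xor_coset v A w = xor_coset v A u"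
  using xor_coset_subset[OF assms] xor_coset_subset[OF assms(1) xor_coset_sym[OF assms(2)]]
  by (rule subset_antisym)

text \<open>Lagrange's theorem for the span of \<open>A\<close>: its cosets partition the 2^d
  vectors into blocks of size 2^|A|.\<close>

lemma card_xor_cosets:
  assumes "finite A" "xor_indep v A" "\<And>y. y \<in> A \<Longrightarrow> v y \<subseteq> {..<d}"
  shows "2 ^ card A * card (xor_coset v A ` Pow {..<d}) = 2 ^ d"
proof -
  have sub: "xor_coset v A u \<subseteq> Pow {..<d}" if "u \<subseteq> {..<d}" for u
  proof -
    have "xor_sum v Y \<subseteq> {..<d}" if "Y \<subseteq> A" for Y
      using that assms(3) by (intro xor_sum_subset) auto
    then show ?thesis using that by (auto simp: xor_coset_def)
  qed
  have Un: "\<Union> (xor_coset v A ` Pow {..<d}) = Pow {..<d}"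
  proof (rule equalityI)
    show "\<Union> (xor_coset v A ` Pow {..<d}) \<subseteq> Pow {..<d}" using sub by (intro Union_least) auto
    show "Pow {..<d} \<subseteq> \<Union> (xor_coset v A ` Pow {..<d})"
    proof
      fix u assume "u \<in> Pow {..<d}"
      then show "u \<in> \<Union> (xor_coset v A ` Pow {..<d})" using xor_coset_self by (rule UN_I)
    qed
  qed
  have "2 ^ card A * card (xor_coset v A ` Pow {..<d}) = card (\<Union> (xor_coset v A ` Pow {..<d}))"
  proof (rule card_partition)
    fix c assume "c \<in> xor_coset v A ` Pow {..<d}"
    then obtain u where c: "c = xor_coset v A u" by (rule imageE)
    then show "card c = 2 ^ card A" by (simp add: card_xor_coset assms)
    fix c' assume c': "c' \<in> xor_coset v A ` Pow {..<d}" and ne: "c \<noteq> c'"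
    from c' obtain u' where "c' = xor_coset v A u'" by (rule imageE)
    then show "c \<inter> c' = {}" using xor_coset_eq[OF assms(1)] c ne by (metis disjoint_iff)
  qed (use Un in auto)
  then show ?thesis using Un by (simp add: card_Pow)
qed

section \<open>Size of a family with pairwise independent unions\<close>

text \<open>Such a \<open>T\<close> is the set of entries of a list of length exactly
  \<open>t\<close>: enumerate \<open>T\<close> and pad by repeating one of its elements, which
  exists as \<open>T\<close> is nonempty.\<close>

lemma card_bounded_nonempty_subsets:
  assumes "finite S"
  shows "card {T. T \<subseteq> S \<and> T \<noteq> {} \<and> card T \<le> t} \<le> card S ^ t"
proof -
  have "{T. T \<subseteq> S \<and> T \<noteq> {} \<and> card T \<le> t} \<subseteq> set ` {xs. set xs \<subseteq> S \<and> length xs = t}"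
  proof
    fix T assume "T \<in> {T. T \<subseteq> S \<and> T \<noteq> {} \<and> card T \<le> t}"
    then have T: "T \<subseteq> S" "T \<noteq> {}" "card T \<le> t" by auto
    then obtain xs where xs: "set xs = T" "distinct xs"
      using assms finite_distinct_list finite_subset by metis
    obtain x where x: "x \<in> T" using T by blast
    have len: "length xs \<le> t" using xs T distinct_card by metis
    have "set (xs @ replicate (t - length xs) x) = T" using xs x by (auto simp: set_replicate_conv_if)
    moreover have "length (xs @ replicate (t - length xs) x) = t" using len by simp
    ultimately show "T \<in> set ` {xs. set xs \<subseteq> S \<and> length xs = t}" using T(1) by blast
  qed
  then have "card {T. T \<subseteq> S \<and> T \<noteq> {} \<and> card T \<le> t} \<le> card {xs. set xs \<subseteq> S \<and> length xs = t}"
    by (rule surj_card_le[OF finite_lists_length_eq[OF assms]])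
  then show ?thesis using card_lists_length_eq[OF assms] by simp
qed

text \<open>Two distinct members \<open>B\<close>, \<open>B'\<close> of \<open>\<B>\<close> with independent union cannot meet the same cosets
  of the span of \<open>A\<close>: an element of \<open>B - B'\<close> and one of \<open>B' - A\<close> in the same coset would yield
  a linear dependence.\<close>

lemma card_pairwise_xor_indep:
  assumes v: "\<And>y. v y \<subseteq> {..<d}" and A: "finite A" "xor_indep v A" "d \<le> card A + L"
    and B: "\<And>B. B \<in> \<B> \<Longrightarrow> finite B \<and> A \<subset> B \<and> card B \<le> d"
    and BB: "\<And>B B'. B \<in> \<B> \<Longrightarrow> B' \<in> \<B> \<Longrightarrow> B \<noteq> B' \<Longrightarrow> xor_indep v (B \<union> B')"
  shows "card \<B> \<le> 2 ^ (L ^ 2)"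
proof -
  let ?c = "\<lambda>y. xor_coset v A (v y)"
  define Q where "Q = xor_coset v A ` Pow {..<d}"
  have finQ: "finite Q" by (simp add: Q_def)
  have "2 ^ card A * card Q = 2 ^ d"
    unfolding Q_def using card_xor_cosets A v by blast
  also have "(2::nat) ^ d \<le> 2 ^ card A * 2 ^ L"
    using A(3) by (metis power_add power_increasing one_le_numeral)
  finally have cQ: "card Q \<le> 2 ^ L" by simp
  have half: "B \<subseteq> B'"
    if BB': "B \<in> \<B>" "B' \<in> \<B>" and img: "?c ` (B - A) = ?c ` (B' - A)" for B B'
  proof
    fix y assume y: "y \<in> B"
    show "y \<in> B'"
    proof (rule ccontr)
      assume ny: "y \<notin> B'"
      then have "y \<in> B - A" using B[OF BB'(2)] y by blast
      then obtain z where z: "z \<in> B' - A" "?c y = ?c z" using img by blast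
      then have "v y \<in> ?c z" using xor_coset_self by blast
      then obtain Y where Y: "Y \<subseteq> A" "v y = sym_diff (v z) (xor_sum v Y)"
        by (auto simp: xor_coset_def)
      have finY: "finite Y" using Y A finite_subset by blast
      \<comment> \<open>\<open>Y\<close> lies in \<open>A\<close>, which misses \<open>y\<close> and
        \<open>z\<close>, and only \<open>z\<close> is in \<open>B'\<close>. Hence nothing is
        counted twice and the sum over all three parts vanishes.\<close>
      have "z \<notin> Y" "y \<notin> insert z Y" using z Y ny \<open>y \<in> B - A\<close> by auto
      then have "xor_sum v (insert y (insert z Y)) = sym_diff (v y) (sym_diff (v z) (xor_sum v Y))"
        using xor_sum_insert finY by (metis finite_insert)
      also have "\<dots> = {}" using Y(2) by blast
      finally have "xor_sum v (insert y (insert z Y)) = {}" .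
      moreover have "insert y (insert z Y) \<subseteq> B \<union> B'" using y z Y B[OF BB'(1)] by blast
      moreover have "xor_indep v (B \<union> B')" using BB[OF BB'] y ny by blast
      ultimately show False unfolding xor_indep_def by blast
    qed
  qed
  have inj: "inj_on (\<lambda>B. ?c ` (B - A)) \<B>"
    using half by (intro inj_onI) (metis subset_antisym)
  \<comment> \<open>Nonemptiness comes from the strict inclusion of \<open>A\<close> in
    \<open>B\<close>, the size bound from |B| - |A| \<le> d - |A| \<le> L.\<close>
  have img: "(\<lambda>B. ?c ` (B - A)) ` \<B> \<subseteq> {T. T \<subseteq> Q \<and> T \<noteq> {} \<and> card T \<le> L}"
  proof (rule image_subsetI)
    fix B assume "B \<in> \<B>"
    note b = B[OF this]
    have "?c ` (B - A) \<subseteq> Q" unfolding Q_def using v by blast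
    moreover have "?c ` (B - A) \<noteq> {}" using b by blast
    moreover have "card (?c ` (B - A)) \<le> card (B - A)" using b by (intro card_image_le) auto
    moreover have "card (B - A) = card B - card A" using b A(1) by (intro card_Diff_subset) auto
    ultimately show "?c ` (B - A) \<in> {T. T \<subseteq> Q \<and> T \<noteq> {} \<and> card T \<le> L}"
      using b A(3) by auto
  qed
  have "finite {T. T \<subseteq> Q \<and> T \<noteq> {} \<and> card T \<le> L}" using finQ by simp
  then have "card \<B> \<le> card {T. T \<subseteq> Q \<and> T \<noteq> {} \<and> card T \<le> L}"
    using card_inj_on_le[OF inj img] by blast
  also have "\<dots> \<le> card Q ^ L" by (rule card_bounded_nonempty_subsets[OF finQ])
  also have "\<dots> \<le> (2 ^ L) ^ L" using cQ by (rule power_mono) simp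
  finally show ?thesis by (simp add: power_mult power2_eq_square)
qed

section \<open>Counting the assignments of vectors that make a set dependent\<close>

text \<open>A fixed nonempty subsum vanishes with probability at most 2^-d: for a chosen
  \<open>y\<close> in \<open>Y\<close>, the value \<open>v y\<close> must be the sum of the others,
  so \<open>v\<close> is determined by its restriction to \<open>I - {y}\<close>.\<close>

lemma card_xor_sum_eq_empty:
  assumes "finite I" "Y \<subseteq> I" "Y \<noteq> {}"
  shows "2 ^ d * card {v \<in> I \<rightarrow>\<^sub>E Pow {..<d}. xor_sum v Y = {}} \<le> card (I \<rightarrow>\<^sub>E Pow {..<d::nat})"
proof -
  obtain y where y: "y \<in> Y" using assms by blast
  let ?Z = "{v \<in> I \<rightarrow>\<^sub>E Pow {..<d}. xor_sum v Y = {}}"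
  let ?r = "\<lambda>v. restrict v (I - {y})"
  have finY: "finite Y" using assms finite_subset by blast
  have det: "v y = xor_sum v (Y - {y})" if "xor_sum v Y = {}" for v
  proof -
    have "xor_sum v (insert y (Y - {y})) = sym_diff (v y) (xor_sum v (Y - {y}))"
      using finY by (intro xor_sum_insert) auto
    then show ?thesis using that y by (simp add: insert_absorb) blast
  qed
  have inj: "inj_on ?r ?Z"
  proof
    fix v w assume v: "v \<in> ?Z" and w: "w \<in> ?Z" and eq: "?r v = ?r w"
    have e: "v x = w x" if "x \<in> I - {y}" for x
      using eq that by (metis restrict_apply')
    have "xor_sum v (Y - {y}) = xor_sum w (Y - {y})"
      using e assms(2) by (intro xor_sum_cong) auto
    then have "v y = w y" using det v w by auto
    then have "\<And>x. x \<in> I \<Longrightarrow> v x = w x" using e by blast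
    then show "v = w" using v w by (intro PiE_ext[of v I _ w]) auto
  qed
  have img: "?r ` ?Z \<subseteq> (I - {y}) \<rightarrow>\<^sub>E Pow {..<d}"
    by (fastforce simp: PiE_iff)
  have fin: "finite ((I - {y}) \<rightarrow>\<^sub>E Pow {..<d})" using assms by (intro finite_PiE) auto
  have "card ?Z \<le> card ((I - {y}) \<rightarrow>\<^sub>E Pow {..<d})"
    by (rule card_inj_on_le[OF inj img fin])
  also have "\<dots> = (2 ^ d) ^ (card I - 1)"
    using assms(1) subsetD[OF assms(2) y] by (simp add: card_PiE card_Pow)
  finally have "2 ^ d * card ?Z \<le> (2 ^ d) ^ Suc (card I - 1)" by simp
  also have "Suc (card I - 1) = card I" 
    using card_Suc_Diff1[OF assms(1) subsetD[OF assms(2) y]]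
      card_Diff_singleton[OF subsetD[OF assms(2) y]] by simp
  also have "(2 ^ d) ^ card I = card (I \<rightarrow>\<^sub>E Pow {..<d})"
    using assms by (simp add: card_PiE card_Pow)
  finally show ?thesis .
qed

text \<open>Union bound: a dependence is a vanishing subsum over one of the fewer than 2^|X|
  nonempty subsets.\<close>

lemma card_not_xor_indep:
  assumes "finite I" "X \<subseteq> I"
  shows "2 ^ d * card {v \<in> I \<rightarrow>\<^sub>E Pow {..<d}. \<not> xor_indep v X}
    \<le> 2 ^ card X * card (I \<rightarrow>\<^sub>E Pow {..<d::nat})"
proof -
  let ?V = "I \<rightarrow>\<^sub>E Pow {..<d}"
  have finX: "finite X" using assms finite_subset by blast
  have "{v \<in> ?V. \<not> xor_indep v X} = (\<Union>Y\<in>Pow X - {{}}. {v \<in> ?V. xor_sum v Y = {}})"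
    unfolding xor_indep_def by blast
  then have "card {v \<in> ?V. \<not> xor_indep v X} \<le> (\<Sum>Y\<in>Pow X - {{}}. card {v \<in> ?V. xor_sum v Y = {}})"
    using finX by (simp add: card_UN_le)
  then have "2 ^ d * card {v \<in> ?V. \<not> xor_indep v X}
      \<le> (\<Sum>Y\<in>Pow X - {{}}. 2 ^ d * card {v \<in> ?V. xor_sum v Y = {}})"
    by (simp flip: sum_distrib_left)
  also have "\<dots> \<le> (\<Sum>Y\<in>Pow X - {{}}. card ?V)"
    using assms by (intro sum_mono card_xor_sum_eq_empty) auto
  also have "\<dots> = (2 ^ card X - 1) * card ?V"
    using finX by (simp add: card_Diff_singleton card_Pow)
  also have "\<dots> \<le> 2 ^ card X * card ?V" by simp
  finally show ?thesis .
qed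

section \<open>A large subfamily of independent sets in consecutive layers\<close>

lemma finite_layer [simp]: "finite (layer n s)"
  unfolding layer_def by (rule finite_subset[of _ "Pow {1..n}"]) auto

lemma card_layer: "card (layer n s) = n choose s"
  using n_subsets[of "{1..n}" s] by (simp add: layer_def)

text \<open>Sizes stop at \<open>d - 1\<close>, which keeps the dependence probability 2^(|X| - d)
  at most 1/2.\<close>

definition indep_layers :: "nat \<Rightarrow> nat \<Rightarrow> nat \<Rightarrow> (nat \<Rightarrow> nat set) \<Rightarrow> nat set set" where
  "indep_layers n d L v = (\<Union>r\<in>{d - L..<d}. {X \<in> layer n r. xor_indep v X})"

lemma exists_large_indep_layers:
  assumes "L \<le> d"
  shows "\<exists>v. (\<forall>y. v y \<subseteq> {..<d}) \<and>
     (\<Sum>r\<in>{d - L..<d}. real (n choose r)) / 2 \<le> real (card (indep_layers n d L v))"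
proof -
  define V where "V = {1..n} \<rightarrow>\<^sub>E Pow {..<d}"
  define R where "R = (\<Union>r\<in>{d - L..<d}. layer n r)"
  have finV: "finite V" unfolding V_def by (intro finite_PiE) auto
  have V0: "card V > 0" unfolding V_def by (simp add: card_PiE card_Pow)
  have finR: "finite R" by (simp add: R_def)
  have cardR: "card R = (\<Sum>r\<in>{d - L..<d}. n choose r)"
    unfolding R_def by (subst card_UN_disjoint) (auto simp: card_layer, auto simp: layer_def)
  have fam: "indep_layers n d L v = {X \<in> R. xor_indep v X}" for v
    by (auto simp: indep_layers_def R_def)
  \<comment> \<open>Since |X| < d, the union bound leaves at most half of the assignments making
    \<open>X\<close> dependent.\<close>
  have X: "card V \<le> 2 * card {v \<in> V. xor_indep v X}" if "X \<in> R" for X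
  proof -
    have x: "X \<subseteq> {1..n}" "card X < d" using that by (auto simp: R_def layer_def)
    have "2 ^ d * card {v \<in> V. \<not> xor_indep v X} \<le> 2 ^ card X * card V"
      unfolding V_def using x by (intro card_not_xor_indep) auto
    moreover have "2 * 2 ^ card X \<le> (2::nat) ^ d"
      using power_increasing[of "Suc (card X)" d "2::nat"] x(2) by simp
    then have "2 * 2 ^ card X * card {v \<in> V. \<not> xor_indep v X} \<le> 2 ^ d * card {v \<in> V. \<not> xor_indep v X}"
      by (rule mult_right_mono) simp
    ultimately have "2 * 2 ^ card X * card {v \<in> V. \<not> xor_indep v X} \<le> 2 ^ card X * card V"
      by (rule order_trans[rotated])
    then have "2 ^ card X * (2 * card {v \<in> V. \<not> xor_indep v X}) \<le> 2 ^ card X * card V"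
      by (simp only: mult_ac)
    then have "2 * card {v \<in> V. \<not> xor_indep v X} \<le> card V" by (rule mult_left_le_imp_le) simp
    moreover have "card V = card {v \<in> V. xor_indep v X} + card {v \<in> V. \<not> xor_indep v X}"
      using finV by (subst card_Un_disjoint[symmetric]) (auto intro!: arg_cong[where f = card])
    ultimately show ?thesis by linarith
  qed
  \<comment> \<open>Double count the pairs of a set \<open>X\<close> and an assignment
    \<open>v\<close> for which \<open>X\<close> is independent; some \<open>v\<close> then does at
    least as well as the average.\<close>
  have "card R * card V \<le> (\<Sum>X\<in>R. 2 * card {v \<in> V. xor_indep v X})"
    using sum_mono[of R "\<lambda>_. card V", OF X] by simp
  also have "\<dots> = 2 * (\<Sum>v\<in>V. card {X \<in> R. xor_indep v X})"
    using sum.swap_restrict[OF finR finV, of "\<lambda>_ _. 1::nat" "\<lambda>X v. xor_indep v X"]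
    by (simp flip: sum_distrib_left)
  finally have le: "card R * card V \<le> 2 * (\<Sum>v\<in>V. card {X \<in> R. xor_indep v X})" .
  have "\<exists>v\<in>V. card R \<le> 2 * card {X \<in> R. xor_indep v X}"
  proof (rule ccontr)
    assume "\<not> ?thesis"
    then have "(\<Sum>v\<in>V. 2 * card {X \<in> R. xor_indep v X}) < (\<Sum>v\<in>V. card R)"
      using finV V0 by (intro sum_strict_mono) auto
    then show False using le by (simp flip: sum_distrib_left add: mult.commute)
  qed
  then obtain v where v: "v \<in> V" "card R \<le> 2 * card {X \<in> R. xor_indep v X}" by blast
  \<comment> \<open>Members of \<open>V\<close> are \<open>undefined\<close> outside [n]; the zero
    vector there gives values in F_2^d everywhere and leaves the sums over subsets of [n]
    unchanged.\<close>
  define w where "w y = (if y \<in> {1..n} then v y else {})" for y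
  have w: "w y \<subseteq> {..<d}" for y using v(1) by (auto simp: w_def V_def)
  have "xor_indep w X = xor_indep v X" if "X \<in> R" for X
  proof -
    have "X \<subseteq> {1..n}" using that by (auto simp: R_def layer_def)
    then have "xor_sum w Y = xor_sum v Y" if "Y \<subseteq> X" for Y
      using that by (intro xor_sum_cong) (auto simp: w_def)
    then show ?thesis by (simp add: xor_indep_def)
  qed
  then have "{X \<in> R. xor_indep w X} = {X \<in> R. xor_indep v X}" by blast
  then have "card R \<le> 2 * card (indep_layers n d L w)" using v fam by simp
  then have "real (card R) / 2 \<le> real (card (indep_layers n d L w))" by linarith
  then show ?thesis using w cardR by (intro exI[of _ w]) simp
qed

section \<open>The poset S_2(m,0) with a chain below it\<close>

lemma Field_S2: "Field (S2 m) = {X. X \<subseteq> {1..m} \<and> card X \<le> 2}"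
  by (auto simp: S2_def Field_def)

lemma finite_Field_S2: "finite (Field (S2 m))"
  unfolding Field_S2 by (rule finite_subset[of _ "Pow {1..m}"]) auto

lemma Partial_order_S2: "Partial_order (S2 m)"
  unfolding partial_order_on_def preorder_on_def Field_S2
  by (auto simp: refl_on_def trans_def antisym_def S2_def)

lemma Field_add_chain_below:
  "Field (add_chain_below j P) = Inl ` {..<j} \<union> Inr ` Field P"
  by (fastforce simp: add_chain_below_def Field_def)

lemma Partial_order_add_chain_below:
  assumes "Partial_order P"
  shows "Partial_order (add_chain_below j P)"
proof -
  let ?Q = "add_chain_below j P"
  have P: "refl_on (Field P) P" "trans P" "antisym P"
    using assms by (auto simp: partial_order_on_def preorder_on_def)
  have "refl_on (Field ?Q) ?Q"
    using refl_onD[OF P(1)] unfolding Field_add_chain_below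
    by (auto simp: add_chain_below_def intro!: refl_onI)
  moreover have "trans ?Q"
  proof (rule transI)
    fix x y z assume "(x, y) \<in> ?Q" "(y, z) \<in> ?Q"
    then show "(x, z) \<in> ?Q"
      by (cases x; cases y; cases z)
        (auto simp: add_chain_below_def dest: transD[OF P(2)] FieldI2)
  qed
  moreover have "antisym ?Q"
  proof (rule antisymI)
    fix x y assume "(x, y) \<in> ?Q" "(y, x) \<in> ?Q"
    then show "x = y"
      by (cases x; cases y) (auto simp: add_chain_below_def dest: antisymD[OF P(3)])
  qed
  moreover have "add_chain_below j P \<subseteq> Field (add_chain_below j P) \<times> Field (add_chain_below j P)"
    by (auto simp: Field_def)
  ultimately show ?thesis by (simp add: partial_order_on_def preorder_on_def)
qed

lemma finite_poset_add_chain_below_S2: "finite_poset (add_chain_below j (S2 m))"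
  unfolding finite_poset_def
proof (intro conjI)
  show "finite (Field (add_chain_below j (S2 m)))"
    using finite_Field_S2 by (simp add: Field_add_chain_below)
  have "Inr {} \<in> Field (add_chain_below j (S2 m))" by (simp add: Field_add_chain_below Field_S2)
  then show "Field (add_chain_below j (S2 m)) \<noteq> {}" by blast
qed (rule Partial_order_add_chain_below[OF Partial_order_S2])

section \<open>Freeness of the independent family and the bound on \<open>La\<close>\<close>

text \<open>In a copy, the images of the \<open>m\<close> singletons would form a family as in
  \<open>card_pairwise_xor_indep\<close>, with the image of the empty set as \<open>A\<close>, but
  \<open>m\<close> exceeds the bound given there.\<close>

lemma weak_free_indep_layers:
  assumes v: "\<And>y. v y \<subseteq> {..<d}" and m: "m > 2 ^ (L ^ 2)" and "L \<le> d"
  shows "weak_free (add_chain_below j (S2 m)) (indep_layers n d L v)"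
  unfolding weak_free_def
proof
  let ?P = "add_chain_below j (S2 m)" and ?F = "indep_layers n d L v"
  assume "\<exists>G\<subseteq>?F. weak_copy ?P G"
  then obtain G \<psi> where G: "G \<subseteq> ?F" and bij: "bij_betw \<psi> (Field ?P) G"
    and mono: "\<And>p p'. (p, p') \<in> ?P \<Longrightarrow> \<psi> p \<subseteq> \<psi> p'" unfolding weak_copy_def by blast
  define g where "g X = \<psi> (Inr X)" for X
  have gF: "g X \<in> ?F" if "X \<subseteq> {1..m}" "card X \<le> 2" for X
    using bij_betwE[OF bij] G that by (auto simp: g_def Field_add_chain_below Field_S2)
  have inj: "g X \<noteq> g Y" if "X \<subseteq> {1..m}" "card X \<le> 2" "Y \<subseteq> {1..m}" "card Y \<le> 2" "X \<noteq> Y" for X Y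
    using inj_onD[OF bij_betw_imp_inj_on[OF bij], of "Inr X" "Inr Y"] that
    by (auto simp: g_def Field_add_chain_below Field_S2)
  have gmono: "g X \<subseteq> g Y" if "X \<subseteq> Y" "Y \<subseteq> {1..m}" "card X \<le> 2" "card Y \<le> 2" for X Y
    using that mono by (auto simp: g_def add_chain_below_def S2_def)
  have F: "finite X" "xor_indep v X" "d \<le> card X + L" "card X \<le> d" if "X \<in> ?F" for X
    using that \<open>L \<le> d\<close> finite_subset[of X "{1..n}"] by (auto simp: indep_layers_def layer_def)
  have inj1: "inj_on (\<lambda>i. g {i}) {1..m}"
    using inj by (intro inj_onI) (metis card_1_singleton_iff empty_subsetI insert_subset
        numeral_2_eq_2 One_nat_def lessI less_imp_le singleton_inject)
  have "card ((\<lambda>i. g {i}) ` {1..m}) \<le> 2 ^ (L ^ 2)"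
  proof (rule card_pairwise_xor_indep[where v = v and d = d and A = "g {}"])
    show "finite (g {})" "xor_indep v (g {})" "d \<le> card (g {}) + L" using F[OF gF[of "{}"]] by auto
    show "finite B \<and> g {} \<subset> B \<and> card B \<le> d" if B: "B \<in> (\<lambda>i. g {i}) ` {1..m}" for B
    proof -
      obtain i where i: "i \<in> {1..m}" "B = g {i}" using B by blast
      then show ?thesis using F[OF gF[of "{i}"]] gmono[of "{}" "{i}"] inj[of "{}" "{i}"] by auto
    qed
    show "xor_indep v (B \<union> B')"
      if BB: "B \<in> (\<lambda>i. g {i}) ` {1..m}" "B' \<in> (\<lambda>i. g {i}) ` {1..m}" for B B'
    proof -
      obtain i i' where i: "i \<in> {1..m}" "B = g {i}" "i' \<in> {1..m}" "B' = g {i'}" using BB by blast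
      have c: "card {i, i'} \<le> 2" by (simp add: card_insert_le_m1)
      \<comment> \<open>This is where the two-element sets of S_2(m,0) enter: they supply an
        independent upper bound of each pair.\<close>
      have "B \<union> B' \<subseteq> g {i, i'}" using i c gmono[of "{i}" "{i, i'}"] gmono[of "{i'}" "{i, i'}"] by auto
      moreover have "xor_indep v (g {i, i'})" using i c by (intro F gF) auto
      ultimately show ?thesis using xor_indep_mono by blast
    qed
  qed (use v in auto)
  then show False using m inj1 by (simp add: card_image)
qed

lemma card_le_La:
  assumes "F \<subseteq> Pow {1..n}" "weak_free P F"
  shows "card F \<le> La n P"
  unfolding La_def
proof (rule Max_ge)
  have "{card F | F. F \<subseteq> Pow {1..n} \<and> weak_free P F} \<subseteq> card ` Pow (Pow {1..n})" by auto
  then show "finite {card F | F. F \<subseteq> Pow {1..n} \<and> weak_free P F}"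
    by (rule finite_subset) simp
qed (use assms in auto)

lemma La_add_chain_below_S2_ge:
  assumes "m > 2 ^ (L ^ 2)" "L \<le> d"
  shows "(\<Sum>r\<in>{d - L..<d}. real (n choose r)) / 2 \<le> real (La n (add_chain_below j (S2 m)))"
proof -
  obtain v where v: "\<And>y. v y \<subseteq> {..<d}"
    "(\<Sum>r\<in>{d - L..<d}. real (n choose r)) / 2 \<le> real (card (indep_layers n d L v))"
    using exists_large_indep_layers[OF assms(2)] by blast
  have "card (indep_layers n d L v) \<le> La n (add_chain_below j (S2 m))"
    using weak_free_indep_layers[of v d L m] v(1) assms
    by (intro card_le_La) (auto simp: indep_layers_def layer_def)
  then show ?thesis using v(2) by linarith
qed

section \<open>Asymptotics of near-central layers and of \<open>pi_minus\<close>\<close>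

text \<open>Each step down multiplies the ratio by C(n,r)/C(n,r+1) = (r+1)/(n-r) with r + 1 =
  \<open>n div 2 - i\<close>, and this factor tends to 1.\<close>

lemma central_binomial_ratio_tendsto:
  "(\<lambda>n. real (n choose (n div 2 - i)) / real (n choose (n div 2))) \<longlonglongrightarrow> 1"
proof (induction i)
  case 0
  have "\<not> n < n div 2" for n :: nat by linarith
  then show ?case by simp
next
  case (Suc i)
  let ?q = "\<lambda>n. real (n div 2 - i) / real (n - (n div 2 - i) + 1)"
  have lim: "?q \<longlonglongrightarrow> 1"
  proof (rule real_tendsto_sandwich)
    show "eventually (\<lambda>n. 1 - real (4 * i + 4) / real n \<le> ?q n) sequentially"
      \<comment> \<open>For such \<open>n\<close> the subtraction \<open>n div 2 - i\<close> is not
        truncated. Then 1 - a/b = (b - a)/b with b - a \<le> 2i + 2 and b \<ge> n/2, which explains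
        the constant 4i + 4.\<close>
      using eventually_gt_at_top[of "2 * i + 2"]
    proof eventually_elim
      case (elim n)
      let ?a = "n div 2 - i" and ?b = "n - (n div 2 - i) + 1"
      have b: "n \<le> 2 * ?b" "?b \<le> ?a + (2 * i + 2)" using elim by presburger+
      have "1 - ?q n = (real ?b - real ?a) / real ?b"
        by (simp add: diff_divide_distrib del: of_nat_diff of_nat_add of_nat_Suc)
      also have "\<dots> \<le> real (2 * i + 2) / real ?b" using b by (intro divide_right_mono) linarith+
      also have "\<dots> \<le> real (2 * i + 2) / (real n / 2)"
        using b elim by (intro divide_left_mono mult_pos_pos) linarith+
      also have "\<dots> = real (4 * i + 4) / real n" by (simp add: field_simps)
      finally show ?case by linarith
    qed
    show "eventually (\<lambda>n. ?q n \<le> 1) sequentially" by (rule always_eventually) auto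
    show "(\<lambda>n. 1 - real (4 * i + 4) / real n) \<longlonglongrightarrow> 1"
      using tendsto_diff[OF tendsto_const lim_const_over_n[of "real (4 * i + 4)"], of 1] by simp
  qed simp
  have "eventually (\<lambda>n. real (n choose (n div 2 - i)) / real (n choose (n div 2)) * ?q n
      = real (n choose (n div 2 - Suc i)) / real (n choose (n div 2))) sequentially"
    using eventually_gt_at_top[of "2 * i + 2"]
  proof eventually_elim
    case (elim n)
    let ?r = "n div 2 - Suc i"
    have r: "n div 2 - i = Suc ?r" using elim by linarith
    have "Suc ?r * (n choose Suc ?r) = (n - ?r) * (n choose ?r)"
      using binomial_absorption[of ?r n] binomial_absorb_comp[of n ?r] elim by simp
    then have "real (Suc ?r) * real (n choose Suc ?r) = real (n - ?r) * real (n choose ?r)"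
      by (metis of_nat_mult)
    moreover have "n - (n div 2 - i) + 1 = n - ?r" "n - ?r > 0" using elim by linarith+
    moreover have "x / c * (a / b) = y / c" if "a * x = b * y" "b > 0" for a b c x y :: real
    proof -
      have "x * (a / b) = y" using that by (simp add: field_simps)
      then have "x * (a / b) / c = y / c" by simp
      then show ?thesis by (simp add: mult.commute)
    qed
    ultimately show ?case by (simp only: r of_nat_0_less_iff)
  qed
  then show ?case using tendsto_mult[OF Suc.IH lim] by (auto elim: Lim_transform_eventually)
qed

lemma pi_minus_add_chain_below_S2_gt:
  assumes "real L > 2 * K" and m: "m > 2 ^ (L ^ 2)"
  shows "pi_minus (add_chain_below j (S2 m)) > ereal K"
proof -
  let ?P = "add_chain_below j (S2 m)"
  let ?x = "\<lambda>n. (\<Sum>i<L. real (n choose (n div 2 - i)) / real (n choose (n div 2))) / 2"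
  have "?x \<longlonglongrightarrow> (\<Sum>i<L. 1) / 2"
    by (intro tendsto_divide tendsto_sum central_binomial_ratio_tendsto tendsto_const) simp
  then have "(\<lambda>n. ereal (?x n)) \<longlonglongrightarrow> ereal (real L / 2)" by simp
  then have "liminf (\<lambda>n. ereal (?x n)) = ereal (real L / 2)"
    by (intro lim_imp_Liminf) auto
  moreover have "liminf (\<lambda>n. ereal (?x n)) \<le> pi_minus ?P"
    unfolding pi_minus_def
  proof (rule Liminf_mono)
    show "eventually (\<lambda>n. ereal (?x n) \<le> ereal (real (La n ?P) / real (n choose (n div 2)))) sequentially"
      using eventually_ge_at_top[of "2 * L"]
    proof eventually_elim
      case (elim n)
      \<comment> \<open>This choice makes the middle layer \<open>d - 1\<close> the top one, so the
        family uses the \<open>L\<close> layers from the middle downwards.\<close>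
      let ?d = "n div 2 + 1"
      have L: "L \<le> ?d" using elim by linarith
      have "(\<Sum>i<L. real (n choose (n div 2 - i))) = (\<Sum>r\<in>{?d - L..<?d}. real (n choose r))"
        by (rule sum.reindex_bij_witness[of _ "\<lambda>r. n div 2 - r" "\<lambda>i. n div 2 - i"]) (use elim in auto)
      then have "(\<Sum>i<L. real (n choose (n div 2 - i))) / 2 \<le> real (La n ?P)"
        using La_add_chain_below_S2_ge[OF m L] by simp
      then have "(\<Sum>i<L. real (n choose (n div 2 - i))) / 2 / real (n choose (n div 2))
          \<le> real (La n ?P) / real (n choose (n div 2))"
        by (rule divide_right_mono) simp
      then show ?case by (simp add: sum_divide_distrib mult.commute)
    qed
  qed
  moreover have "ereal K < ereal (real L / 2)" using assms(1) by simp
  ultimately show ?thesis by order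
qed

section \<open>Computation of \<open>e_num\<close>\<close>

text \<open>The chain \<open>g 0\<close>, ..., \<open>g k\<close> has k + 1 elements. Their images
  grow strictly from size at least \<open>s\<close>, so the last one has size at least
  \<open>s + k\<close>, above all \<open>k\<close> layers.\<close>

lemma weak_free_layers_of_chain:
  assumes "\<And>i. i \<le> k \<Longrightarrow> g i \<in> Field P"
    and "\<And>i. i < k \<Longrightarrow> (g i, g (Suc i)) \<in> P \<and> g i \<noteq> g (Suc i)"
  shows "weak_free P (\<Union>i\<in>{s..<s + k}. layer n i)"
  unfolding weak_free_def
proof
  let ?F = "\<Union>i\<in>{s..<s + k}. layer n i"
  assume "\<exists>G\<subseteq>?F. weak_copy P G"
  then obtain G \<psi> where G: "G \<subseteq> ?F" and bij: "bij_betw \<psi> (Field P) G"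
    and mono: "\<And>p p'. (p, p') \<in> P \<Longrightarrow> \<psi> p \<subseteq> \<psi> p'" unfolding weak_copy_def by blast
  have F: "\<psi> (g i) \<in> ?F" if "i \<le> k" for i
    using bij_betwE[OF bij] G assms(1)[OF that] by blast
  then have fin: "finite (\<psi> (g i))" if "i \<le> k" for i
    using that finite_subset[of _ "{1..n}"] by (fastforce simp: layer_def)
  have "s + i \<le> card (\<psi> (g i))" if "i \<le> k" for i
    using that
  proof (induction i)
    case 0
    then show ?case using F[of 0] by (auto simp: layer_def)
  next
    case (Suc i)
    have "\<psi> (g i) \<noteq> \<psi> (g (Suc i))"
      using bij_betw_imp_inj_on[OF bij] assms Suc.prems by (metis Suc_le_eq inj_onD less_imp_le)
    then have "\<psi> (g i) \<subset> \<psi> (g (Suc i))" using mono assms(2)[of i] Suc.prems by auto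
    then have "card (\<psi> (g i)) < card (\<psi> (g (Suc i)))" using fin Suc.prems by (intro psubset_card_mono) auto
    then show ?case using Suc by auto
  qed
  from this[of k] show False using F[of k] by (auto simp: layer_def)
qed

text \<open>The new chain goes to initial segments of sizes 0, ..., j - 1, and S_2(m,0) to {1..j}
  joined with a shifted copy, of sizes j to j + 2; thus the lowest j + 3 layers suffice.\<close>

lemma weak_copy_add_chain_below_S2:
  assumes "j + m \<le> n" "j + 3 \<le> l"
  shows "\<not> weak_free (add_chain_below j (S2 m)) (\<Union>i\<in>{0..<l}. layer n i)"
proof -
  let ?P = "add_chain_below j (S2 m)" and ?F = "\<Union>i\<in>{0..<l}. layer n i"
  define f where "f X = {1..j} \<union> (\<lambda>x. j + x) ` X" for X :: "nat set"
  define \<psi> where "\<psi> = case_sum (\<lambda>a. {1..a}) f"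
  have f_card: "card (f X) = j + card X" if "X \<subseteq> {1..m}" for X
  proof -
    have "finite X" using that finite_subset by blast
    moreover have "{1..j} \<inter> (\<lambda>x. j + x) ` X = {}" using that by fastforce
    ultimately show ?thesis unfolding f_def by (subst card_Un_disjoint) (auto simp: card_image)
  qed
  have f_inj: "X = Y" if "f X = f Y" "X \<subseteq> {1..m}" "Y \<subseteq> {1..m}" for X Y
  proof -
    \<comment> \<open>The guard \<open>x \<ge> 1\<close> excludes x = 0, for which j + x may fall
      into {1..j}.\<close>
    have "X = {x. x \<ge> 1 \<and> j + x \<in> f X}" if "X \<subseteq> {1..m}" for X using that by (auto simp: f_def)
    then show ?thesis using that by metis
  qed
  have inj: "inj_on \<psi> (Field ?P)"
  proof -
    \<comment> \<open>Sizes separate the two parts: \<open>a < j\<close>, whereas \<open>f X\<close>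
      has at least \<open>j\<close> elements.\<close>
    have ne: "{1..a} \<noteq> f X" if "a < j" "X \<subseteq> {1..m}" for a X
      using that f_card[of X] by (metis card_atLeastAtMost diff_Suc_1 le_add1 linorder_not_less)
    show ?thesis
    proof (rule inj_onI)
      fix p q assume p: "p \<in> Field ?P" "q \<in> Field ?P" "\<psi> p = \<psi> q"
      show "p = q"
      proof (cases p; cases q)
        fix a b assume "p = Inl a" "q = Inl b"
        then have "{1..a} = {1..b}" using p(3) by (simp only: \<psi>_def sum.case)
        then have "a = b" by (metis card_atLeastAtMost diff_Suc_1)
        then show ?thesis using \<open>p = Inl a\<close> \<open>q = Inl b\<close> by simp
      next
        fix X Y assume XY: "p = Inr X" "q = Inr Y"
        have "X = Y"
          by (rule f_inj) (use p XY in \<open>auto simp: \<psi>_def Field_add_chain_below Field_S2\<close>)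
        then show ?thesis using XY by simp
      qed (use p ne ne[symmetric] in \<open>auto simp: \<psi>_def Field_add_chain_below Field_S2\<close>)
    qed
  qed
  have mono: "\<psi> p \<subseteq> \<psi> p'" if pp': "(p, p') \<in> ?P" for p p'
  proof -
    have "f X \<subseteq> f Y" if "X \<subseteq> Y" for X Y using that unfolding f_def by blast
    moreover have "{1..a} \<subseteq> f X" if "a < j" for a X using that by (auto simp: f_def)
    ultimately show ?thesis
      using pp' by (cases p; cases p') (simp_all add: \<psi>_def add_chain_below_def S2_def)
  qed
  have img: "\<psi> ` Field ?P \<subseteq> ?F"
  proof (rule image_subsetI)
    fix p assume p: "p \<in> Field ?P"
    show "\<psi> p \<in> ?F"
    proof (cases p)
      case (Inl a)
      then show ?thesis using p assms by (auto simp: \<psi>_def layer_def Field_add_chain_below)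
    next
      case (Inr X)
      then have X: "X \<subseteq> {1..m}" "card X \<le> 2" using p by (auto simp: Field_add_chain_below Field_S2)
      then have "f X \<subseteq> {1..n}" using assms by (fastforce simp: f_def)
      then show ?thesis using Inr X f_card[OF X(1)] assms by (simp add: \<psi>_def layer_def)
    qed
  qed
  have "weak_copy ?P (\<psi> ` Field ?P)"
    unfolding weak_copy_def using inj mono by (auto simp: bij_betw_def)
  then show ?thesis unfolding weak_free_def using img by blast
qed

text \<open>The \<open>j\<close> new elements followed by the empty set, {1} and {1,2} form a chain
  of j + 3 elements, which rules out j + 2 layers; the lowest j + 3 layers of a large cube do
  contain a copy.\<close>

lemma e_num_add_chain_below_S2:
  assumes "m \<ge> 2"
  shows "e_num (add_chain_below j (S2 m)) = j + 2"
  unfolding e_num_def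
proof (rule Greatest_equality)
  let ?P = "add_chain_below j (S2 m)"
  \<comment> \<open>At i = j the set {1..0} is empty, so the chain passes through the minimum of
    S_2(m,0).\<close>
  define g where "g i = (if i < j then Inl i else Inr {1..i - j})" for i
  have g_Field: "g i \<in> Field ?P" if i: "i \<le> j + 2" for i
  proof (cases "i < j")
    case False
    then have "{1..i - j} \<subseteq> {1..m}" "card {1..i - j} \<le> 2" using i assms by auto
    then show ?thesis using False by (simp add: g_def Field_add_chain_below Field_S2)
  qed (simp add: g_def Field_add_chain_below)
  have g_chain: "(g i, g (Suc i)) \<in> ?P \<and> g i \<noteq> g (Suc i)" if i: "i < j + 2" for i
  proof -
    consider "Suc i < j" | "Suc i = j" | "j \<le> i" by linarith
    then show ?thesis
    proof cases
      case 3
      let ?X = "{1..i - j}" and ?Y = "{1..Suc i - j}"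
      have "?X \<subseteq> ?Y" "?Y \<subseteq> {1..m}" "card ?X \<le> 2" "card ?Y \<le> 2" "card ?X \<noteq> card ?Y"
        using 3 i assms by auto
      moreover from this have "?X \<noteq> ?Y" by metis
      moreover have "g i = Inr ?X" "g (Suc i) = Inr ?Y" using 3 by (simp_all add: g_def)
      ultimately show ?thesis by (simp add: add_chain_below_def S2_def)
    qed (auto simp: g_def add_chain_below_def Field_S2)
  qed
  show "\<forall>n s. s + (j + 2) \<le> n + 1 \<longrightarrow> weak_free ?P (\<Union>i\<in>{s..<s + (j + 2)}. layer n i)"
    using weak_free_layers_of_chain[of "j + 2" g ?P, OF g_Field g_chain] by blast
  fix l assume l: "\<forall>n s. s + l \<le> n + 1 \<longrightarrow> weak_free ?P (\<Union>i\<in>{s..<s + l}. layer n i)"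
  \<comment> \<open>The dimension j + m + l is large enough both for \<open>l\<close> layers to
    exist and for the embedding, which needs j + m points.\<close>
  have free: "weak_free ?P (\<Union>i\<in>{0..<l}. layer (j + m + l) i)"
    using l[rule_format, of 0 "j + m + l"] by simp
  show "l \<le> j + 2"
  proof (rule ccontr)
    assume "\<not> l \<le> j + 2"
    then show False using weak_copy_add_chain_below_S2[of j m "j + m + l" l] free by simp
  qed
qed

section \<open>Relabelling the ground set by natural numbers\<close>

lemma weak_copy_dir_image:
  assumes "inj_on f (Field P)"
  shows "weak_copy (dir_image P f) G \<longleftrightarrow> weak_copy P G"
proof
  assume "weak_copy (dir_image P f) G"
  then obtain \<psi> where \<psi>: "bij_betw \<psi> (f ` Field P) G" "\<forall>p p'. (p, p') \<in> dir_image P f \<longrightarrow> \<psi> p \<subseteq> \<psi> p'"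
    unfolding weak_copy_def dir_image_Field by blast
  have "bij_betw (\<psi> \<circ> f) (Field P) G"
    using bij_betw_trans[OF inj_on_imp_bij_betw[OF assms] \<psi>(1)] .
  then show "weak_copy P G" unfolding weak_copy_def using \<psi>(2)
    by (intro exI[of _ "\<psi> \<circ> f"]) (auto simp: dir_image_def)
next
  assume "weak_copy P G"
  then obtain \<psi> where \<psi>: "bij_betw \<psi> (Field P) G" "\<forall>p p'. (p, p') \<in> P \<longrightarrow> \<psi> p \<subseteq> \<psi> p'"
    unfolding weak_copy_def by blast
  let ?h = "inv_into (Field P) f"
  have "bij_betw (\<psi> \<circ> ?h) (f ` Field P) G"
    using bij_betw_trans[OF bij_betw_inv_into[OF inj_on_imp_bij_betw[OF assms]] \<psi>(1)] .
  moreover have "(\<psi> \<circ> ?h) q \<subseteq> (\<psi> \<circ> ?h) q'" if qq': "(q, q') \<in> dir_image P f" for q q'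
  proof -
    obtain a b where ab: "(a, b) \<in> P" "q = f a" "q' = f b" using qq' by (auto simp: dir_image_def)
    then have "?h q = a" "?h q' = b"
      using inv_into_f_f[OF assms FieldI1[OF ab(1)]] inv_into_f_f[OF assms FieldI2[OF ab(1)]] by auto
    then show ?thesis using \<psi>(2) ab by simp
  qed
  ultimately show "weak_copy (dir_image P f) G" unfolding weak_copy_def dir_image_Field by blast
qed

lemma finite_poset_dir_image:
  assumes "finite_poset P" "inj_on f (Field P)"
  shows "finite_poset (dir_image P f)"
  using assms Partial_order_dir_image[of P f] by (simp add: finite_poset_def dir_image_Field)

text \<open>The existential claim asks for a poset on \<open>nat\<close>, while the construction
  lives on \<open>nat + nat set\<close>. Both parameters see the poset only through
  \<open>weak_free\<close>, which an injective relabelling preserves.\<close>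

lemma exists_nat_copy:
  assumes "finite_poset P"
  shows "\<exists>Q :: nat rel. finite_poset Q \<and> e_num Q = e_num P \<and> pi_minus Q = pi_minus P"
proof -
  have "finite (Field P)" using assms by (simp add: finite_poset_def)
  then obtain f :: "'a \<Rightarrow> nat" where f: "inj_on f (Field P)"
    using finite_imp_inj_to_nat_seg by metis
  have "weak_free (dir_image P f) F = weak_free P F" for F :: "nat set set"
    by (simp add: weak_free_def weak_copy_dir_image[OF f])
  then have "e_num (dir_image P f) = e_num P" "pi_minus (dir_image P f) = pi_minus P"
    by (simp_all add: e_num_def pi_minus_def La_def)
  then show ?thesis using finite_poset_dir_image[OF assms f] by blast
qed

theorem mainTheorem5:
  fixes k :: nat and K :: real
  assumes "k \<ge> 3" and "K > 0"
  shows "(\<exists>P :: nat rel. finite_poset P \<and> e_num P = k \<and> pi_minus P > ereal K)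
       \<and> (\<forall>(L::nat) (m::nat). real L > 2 * K \<and> m = 2 ^ (L ^ 2) + 1 \<longrightarrow>
            finite_poset (add_chain_below (k - 2) (S2 m))
            \<and> e_num (add_chain_below (k - 2) (S2 m)) = k
            \<and> pi_minus (add_chain_below (k - 2) (S2 m)) > ereal K)"
proof -
  let ?P = "\<lambda>m. add_chain_below (k - 2) (S2 m)"
  have main: "finite_poset (?P m) \<and> e_num (?P m) = k \<and> pi_minus (?P m) > ereal K"
    if "real L > 2 * K" "m = 2 ^ (L ^ 2) + 1" for L m :: nat
  proof -
    \<comment> \<open>This yields m \<ge> 2, so that {1,2} is available for the chain computing
      \<open>e_num\<close>.\<close>
    have "(2::nat) ^ (L ^ 2) \<ge> 1" by simp
    then have "m \<ge> 2" using that(2) by linarith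
    then have "e_num (?P m) = k" using e_num_add_chain_below_S2[of m "k - 2"] assms(1) by simp
    then show ?thesis
      using finite_poset_add_chain_below_S2 pi_minus_add_chain_below_S2_gt[OF that(1), of m] that(2)
      by auto
  qed
  obtain L :: nat where L: "real L > 2 * K" using reals_Archimedean2 by blast
  have "\<exists>P :: nat rel. finite_poset P \<and> e_num P = k \<and> pi_minus P > ereal K"
    using exists_nat_copy[of "?P (2 ^ (L ^ 2) + 1)"] main[OF L refl] by metis
  then show ?thesis using main by blast
qed

end
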